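(* Let $h\geq 3$ be an integer and let $\alpha$ be a real number with $0<\alpha<1/h$. Then there exists a set $A'\subseteq\mathbb{N}_0$ which is a minimal asymptotic basis of order $h$ and whose asymptotic density exists and satisfies $d(A')=\alpha$.
   Context: Let $\mathbb{N}$ be the set of positive integers and $\mathbb{N}_0=\mathbb{N}\cup\{0\}$. For $A\subseteq\mathbb{N}_0$, a real number $x\geq 1$ and a positive integer $h$, put $A(x)=|A\cap[1,x]|$ and $hA=\{a_1+\cdots+a_h : a_1,\ldots,a_h\in A\}$ (the summands need not be distinct). The set $A$ is called an asymptotic basis of order $h$ if $hA$ contains every sufficiently large integer. An asymptotic basis $A$ of order $h$ is called minimal if no proper subset of $A$ is an asymptotic basis of order $h$. If the limit $\lim_{x\to\infty}A(x)/x$ exists, it is called the asymptotic density of $A$ and is denoted by $d(A)$. *)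

theory Defs
  imports Complex_Main
begin

definition counting :: "nat set \<Rightarrow> real \<Rightarrow> nat" where
  "counting A x = card {a \<in> A. 1 \<le> real a \<and> real a \<le> x}"

text \<open>The summands are given by an indexing function, so they need not be distinct.\<close>

definition hfold_sumset :: "nat \<Rightarrow> nat set \<Rightarrow> nat set" where
  "hfold_sumset h A = {\<Sum>i<h. a i | a. \<forall>i<h. a i \<in> A}"

definition asymptotic_basis :: "nat \<Rightarrow> nat set \<Rightarrow> bool" where
  "asymptotic_basis h A \<longleftrightarrow> (\<exists>n\<^sub>0. \<forall>n\<ge>n\<^sub>0. n \<in> hfold_sumset h A)"

definition minimal_asymptotic_basis :: "nat \<Rightarrow> nat set \<Rightarrow> bool" where
  "minimal_asymptotic_basis h A \<longleftrightarrow>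
     asymptotic_basis h A \<and> (\<forall>B. B \<subset> A \<longrightarrow> \<not> asymptotic_basis h B)"

text \<open>The density exists and equals \<open>d\<close>; the limit is over real \<open>x\<close>.\<close>

definition has_asymptotic_density :: "nat set \<Rightarrow> real \<Rightarrow> bool" where
  "has_asymptotic_density A d \<longleftrightarrow> ((\<lambda>x::real. real (counting A x) / x) \<longlongrightarrow> d) at_top"

end

(* Put k = h - 1 and let A' consist of the numbers h c (c in C) and h g + 1 (g in G), where C has
   density h alpha and G is very sparse. Modulo h, a sum of h elements of A' lies in the class
   of -1 only if it uses exactly one number h c and k numbers h g + 1. So A' is a basis once
   C + C and C + kG contain all large integers, and it is minimal once,
   for every element c of C or g of G, infinitely many N have all their representations in C + kG
   involving that element.
   Let G = {g_0 = 0 < g_1 < ...} consist of even numbers growing very fast and with g_j = 2j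
   modulo an odd M, and let C consist of a set of density h alpha containing all multiples of M,
   together with full intervals (of total density 0) around the first multiples of each g_i, from
   which some points are deleted again. To make c indispensable take N = k g_i + c and delete all
   N - s with s in kG, s different from k g_i; to make g_d indispensable take N = (k+1) g_i + g_d
   and delete all N - s with s in k(G - {g_d}). The points deleted for one N have one parity, which
   saves C + C; and if both y and y - k g_(i-1) were deleted, then s and s + k g_(i-1) would both
   lie in kG, which forces s = 0 and y = N, and N is still represented. *)
theory Submission
  imports Defs "HOL-Library.Nat_Bijection"
begin

section \<open>Sumsets\<close>

lemma hfold_sumset_0: "hfold_sumset 0 A = {0}"
  by (auto simp: hfold_sumset_def)

lemma hfold_sumset_Suc:
  "hfold_sumset (Suc h) A = {s + a | s a. s \<in> hfold_sumset h A \<and> a \<in> A}"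
proof (intro set_eqI iffI)
  fix x assume "x \<in> hfold_sumset (Suc h) A"
  then obtain f where f: "x = (\<Sum>i<Suc h. f i)" "\<forall>i<Suc h. f i \<in> A"
    by (auto simp: hfold_sumset_def)
  then have "x = (\<Sum>i<h. f i) + f h" "(\<Sum>i<h. f i) \<in> hfold_sumset h A" "f h \<in> A"
    by (auto simp: hfold_sumset_def)
  then show "x \<in> {s + a | s a. s \<in> hfold_sumset h A \<and> a \<in> A}" by blast
next
  fix x assume "x \<in> {s + a | s a. s \<in> hfold_sumset h A \<and> a \<in> A}"
  then obtain f a where f: "x = (\<Sum>i<h. f i) + a" "\<forall>i<h. f i \<in> A" "a \<in> A"
    by (auto simp: hfold_sumset_def)
  define f' where "f' = f(h := a)"
  have "(\<Sum>i<h. f' i) = (\<Sum>i<h. f i)"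
    by (rule sum.cong) (auto simp: f'_def)
  then have "x = (\<Sum>i<Suc h. f' i)" "\<forall>i<Suc h. f' i \<in> A"
    using f by (auto simp: f'_def less_Suc_eq)
  then show "x \<in> hfold_sumset (Suc h) A"
    unfolding hfold_sumset_def by blast
qed

lemma hfold_sumset_add:
  assumes "s \<in> hfold_sumset m A" and "t \<in> hfold_sumset n A"
  shows "s + t \<in> hfold_sumset (m + n) A"
  using assms(2)
proof (induction n arbitrary: t)
  case 0
  then show ?case using assms(1) by (simp add: hfold_sumset_0)
next
  case (Suc n)
  then obtain t' a where t': "t = t' + a" "t' \<in> hfold_sumset n A" "a \<in> A"
    by (auto simp: hfold_sumset_Suc)
  have "s + t' \<in> hfold_sumset (m + n) A" using Suc.IH t' by blast
  then have "(s + t') + a \<in> hfold_sumset (Suc (m + n)) A"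
    using t'(3) unfolding hfold_sumset_Suc by blast
  then show ?case using t' by (simp add: add.assoc)
qed

lemma hfold_sumset_1: "hfold_sumset 1 A = A"
  using hfold_sumset_Suc[of 0 A] by (auto simp: hfold_sumset_0)

lemma mult_in_hfold_sumset: "a \<in> A \<Longrightarrow> n * a \<in> hfold_sumset n A"
  unfolding hfold_sumset_def by (auto intro!: exI[of _ "\<lambda>_. a"])

lemma elem_in_hfold_sumset:
  assumes "a \<in> A" and "0 \<in> A" and "1 \<le> n"
  shows "a \<in> hfold_sumset n A"
proof -
  obtain m where m: "n = Suc m" using assms(3) by (cases n) auto
  have "0 \<in> hfold_sumset m A" using mult_in_hfold_sumset[OF assms(2), of m] by simp
  then have "0 + a \<in> hfold_sumset (Suc m) A" using assms(1) unfolding hfold_sumset_Suc by blast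
  then show ?thesis using m by simp
qed

lemma hfold_sumset_mono: "A \<subseteq> B \<Longrightarrow> hfold_sumset n A \<subseteq> hfold_sumset n B"
  unfolding hfold_sumset_def by blast

text \<open>Every summand of \<open>s\<close> is at most \<open>s\<close>, so the bound is asked
  only of such elements; this makes the lemma usable for infinite \<open>A\<close>.\<close>

lemma in_hfold_sumset_le:
  "s \<in> hfold_sumset n A \<Longrightarrow> (\<And>a. a \<in> A \<Longrightarrow> a \<le> s \<Longrightarrow> a \<le> b) \<Longrightarrow> s \<le> n * b"
proof (induction n arbitrary: s)
  case (Suc n)
  then obtain t a where t: "s = t + a" "t \<in> hfold_sumset n A" "a \<in> A"
    by (auto simp: hfold_sumset_Suc)
  have "t \<le> n * b" using Suc.IH t Suc.prems(2) by force
  moreover have "a \<le> b" using Suc.prems(2) t by simp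
  ultimately show ?case using t by simp
qed (simp add: hfold_sumset_0)

lemma even_hfold_sumset:
  "(\<And>a. a \<in> A \<Longrightarrow> even a) \<Longrightarrow> s \<in> hfold_sumset n A \<Longrightarrow> even s"
  unfolding hfold_sumset_def by (auto intro!: dvd_sum)

lemma sum_in_hfold_sumset:
  assumes "finite I" and "\<And>i. i \<in> I \<Longrightarrow> f i \<in> A"
  shows "sum f I \<in> hfold_sumset (card I) A"
  using assms
proof (induction I rule: finite_induct)
  case (insert i I)
  then have "sum f I + f i \<in> hfold_sumset (Suc (card I)) A"
    unfolding hfold_sumset_Suc by blast
  then show ?case using insert by (simp add: add.commute)
qed (simp add: hfold_sumset_0)

section \<open>Lifting a pair of sets to two residue classes\<close>

definition lift_pair :: "nat \<Rightarrow> nat set \<Rightarrow> nat set \<Rightarrow> nat set" where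
  "lift_pair h C G = (\<lambda>c. h * c) ` C \<union> (\<lambda>g. Suc (h * g)) ` G"

text \<open>Modulo \<open>h\<close> a lifted element of \<open>C\<close> contributes 0 and one of
  \<open>G\<close> contributes 1, so the residue of a sum reveals how many summands come from
  \<open>G\<close>.\<close>

lemma lift_pair_sumset_top:
  assumes h: "h = Suc k" "1 \<le> k"
  shows "h * N + k \<in> hfold_sumset h (lift_pair h C G)
    \<longleftrightarrow> (\<exists>c\<in>C. \<exists>s\<in>hfold_sumset k G. N = c + s)" (is "?L \<longleftrightarrow> ?R")
proof
  assume ?R
  then obtain c f where c: "c \<in> C" and f: "\<forall>i<k. f i \<in> G" and N: "N = c + (\<Sum>i<k. f i)"
    unfolding hfold_sumset_def by blast
  have "(\<Sum>i<k. Suc (h * f i)) \<in> hfold_sumset k (lift_pair h C G)"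
    using f by (auto simp: hfold_sumset_def lift_pair_def intro!: exI[of _ "\<lambda>i. Suc (h * f i)"])
  then have "(\<Sum>i<k. Suc (h * f i)) + h * c \<in> hfold_sumset h (lift_pair h C G)"
    using c unfolding h hfold_sumset_Suc by (auto simp: lift_pair_def)
  moreover have "(\<Sum>i<k. Suc (h * f i)) + h * c = h * N + k"
    unfolding N sum_Suc by (simp add: sum_distrib_left algebra_simps)
  ultimately show ?L by simp
next
  assume ?L
  then obtain f where f: "\<forall>i<h. f i \<in> lift_pair h C G" and sum_f: "h * N + k = (\<Sum>i<h. f i)"
    unfolding hfold_sumset_def by auto
  have h2: "2 \<le> h" using h by simp
  define q where "q i = f i div h" for i
  define r where "r i = f i mod h" for i
  have fqr: "f i = h * q i + r i" for i by (simp add: q_def r_def)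
  have qr: "(r i = 0 \<and> q i \<in> C) \<or> (r i = 1 \<and> q i \<in> G)" if "i < h" for i
  proof -
    from f that have "f i \<in> lift_pair h C G" by blast
    then consider c where "c \<in> C" "f i = h * c" | g where "g \<in> G" "f i = Suc (h * g)"
      by (auto simp: lift_pair_def)
    then show ?thesis
    proof cases
      case 1
      then show ?thesis using h2 by (simp add: q_def r_def)
    next
      case 2
      have "Suc (h * g) div h = g" "Suc (h * g) mod h = 1"
        using h2 by (simp_all add: div_nat_eqI mod_Suc)
      then show ?thesis using 2 by (simp add: q_def r_def)
    qed
  qed
  define I where "I = {i. i < h \<and> r i = 1}"
  have fin: "finite I" by (simp add: I_def)
  have sum_r: "(\<Sum>i<h. r i) = card I"
  proof -
    have "(\<Sum>i<h. r i) = (\<Sum>i<h. if r i = 1 then 1 else 0)"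
      by (rule sum.cong) (use qr in force)+
    also have "\<dots> = card {i \<in> {..<h}. r i = 1}"
      by (subst sum.If_cases) (auto simp: Int_def)
    finally show ?thesis by (simp add: I_def lessThan_def)
  qed
  have eq: "h * N + k = h * (\<Sum>i<h. q i) + card I"
    unfolding sum_f sum_r[symmetric] fqr by (simp add: sum.distrib sum_distrib_left)
  have "card I \<le> card {..<h}" by (rule card_mono) (auto simp: I_def)
  then have le: "card I \<le> h" by simp
  have "k mod h = k" using h by simp
  then have "(h * N + k) mod h = k" by simp
  then have "card I mod h = k" unfolding eq by simp
  \<comment> \<open>Among \<open>0, ..., h\<close> only \<open>k\<close> is congruent to
    \<open>k\<close> modulo \<open>h\<close>: the other extreme value \<open>h\<close> has residue
    0, and \<open>k\<close> is positive.\<close>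
  with le h have cardI: "card I = k" by (cases "card I = h") auto
  then have "h * N = h * (\<Sum>i<h. q i)" and "h \<noteq> 0" using eq h by simp_all
  then have NQ: "N = (\<Sum>i<h. q i)" by simp
  have "card ({..<h} - I) = 1"
    using cardI h fin by (subst card_Diff_subset) (auto simp: I_def)
  then obtain i0 where i0: "{..<h} - I = {i0}" by (auto simp: card_1_singleton_iff)
  then have i0h: "i0 < h" "i0 \<notin> I" by auto
  then have "q i0 \<in> C" using qr[of i0] by (auto simp: I_def)
  moreover have "sum q I \<in> hfold_sumset k G"
    using sum_in_hfold_sumset[OF fin, of q G] qr cardI by (force simp: I_def)
  moreover have "N = q i0 + sum q I"
  proof -
    have "{..<h} = insert i0 I" using i0 by (auto simp: I_def)
    then show ?thesis unfolding NQ using i0h fin by simp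
  qed
  ultimately show ?R by blast
qed

text \<open>Below residue \<open>k\<close> there is room for two elements of \<open>C\<close>:
  \<open>r\<close> copies of 1 (the lift of \<open>0 \<in> G\<close>) fix the residue, and zeros pad
  the sum to \<open>h\<close> terms.\<close>

lemma lift_pair_sumset_low:
  assumes "h = Suc k" and "r < k" and "0 \<in> C" and "0 \<in> G" and "c \<in> C" and "d \<in> C"
  shows "h * (c + d) + r \<in> hfold_sumset h (lift_pair h C G)"
proof -
  let ?A = "lift_pair h C G"
  have mem: "0 \<in> ?A" "1 \<in> ?A" "h * c \<in> ?A" "h * d \<in> ?A"
    using assms(3-6) by (force simp: lift_pair_def)+
  have "h * c + h * d \<in> hfold_sumset (1 + 1) ?A"
    using hfold_sumset_add[of "h * c" 1 ?A "h * d" 1] mem unfolding hfold_sumset_1 by simp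
  moreover have "r * 1 \<in> hfold_sumset r ?A" "(k - 1 - r) * 0 \<in> hfold_sumset (k - 1 - r) ?A"
    using mem mult_in_hfold_sumset by blast+
  ultimately have "(h * c + h * d) + r * 1 + (k - 1 - r) * 0
      \<in> hfold_sumset ((1 + 1) + r + (k - 1 - r)) ?A"
    using hfold_sumset_add by blast
  moreover have "(1 + 1) + r + (k - 1 - r) = h" using assms(1,2) by simp
  ultimately show ?thesis by (simp add: algebra_simps)
qed

lemma lift_pair_asymptotic_basis:
  assumes h: "h = Suc k" "1 \<le> k" and zero: "0 \<in> C" "0 \<in> G"
    and two: "\<And>n. n \<ge> n\<^sub>0 \<Longrightarrow> \<exists>c\<in>C. \<exists>d\<in>C. n = c + d"
    and top: "\<And>n. n \<ge> n\<^sub>0 \<Longrightarrow> \<exists>c\<in>C. \<exists>s\<in>hfold_sumset k G. n = c + s"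
  shows "asymptotic_basis h (lift_pair h C G)"
  unfolding asymptotic_basis_def
proof (intro exI allI impI)
  fix n assume n: "n \<ge> h * n\<^sub>0"
  define N where "N = n div h"
  have N: "N \<ge> n\<^sub>0"
    using n h less_eq_div_iff_mult_less_eq[of h n\<^sub>0 n] by (simp add: N_def mult.commute)
  have neq: "n = h * N + n mod h" by (simp add: N_def)
  have "n mod h < h" using h by simp
  then consider "n mod h < k" | "n mod h = k" using h by linarith
  then show "n \<in> hfold_sumset h (lift_pair h C G)"
  proof cases
    case 1
    obtain c d where "c \<in> C" "d \<in> C" "N = c + d" using two N by blast
    then show ?thesis using lift_pair_sumset_low[OF h(1) 1 zero] neq by metis
  next
    case 2
    then show ?thesis using lift_pair_sumset_top[OF h] top[OF N] neq by metis
  qed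
qed

text \<open>A proper subset misses the lift of some \<open>c\<close> or \<open>g\<close>, hence lies
  in the lift of the pair without that element; an \<open>N\<close> not represented by this smaller
  pair leaves \<open>h * N + k\<close> unrepresented.\<close>

lemma lift_pair_minimal:
  assumes h: "h = Suc k" "1 \<le> k"
    and basis: "asymptotic_basis h (lift_pair h C G)"
    and needC: "\<And>c m. c \<in> C \<Longrightarrow> \<exists>N\<ge>m. \<not> (\<exists>c'\<in>C - {c}. \<exists>s\<in>hfold_sumset k G. N = c' + s)"
    and needG: "\<And>g m. g \<in> G \<Longrightarrow> \<exists>N\<ge>m. \<not> (\<exists>c'\<in>C. \<exists>s\<in>hfold_sumset k (G - {g}). N = c' + s)"
  shows "minimal_asymptotic_basis h (lift_pair h C G)"
  unfolding minimal_asymptotic_basis_def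
proof (intro conjI allI impI notI)
  fix B assume B: "B \<subset> lift_pair h C G" and basB: "asymptotic_basis h B"
  from basB obtain n\<^sub>0 where n0: "\<And>n. n \<ge> n\<^sub>0 \<Longrightarrow> n \<in> hfold_sumset h B"
    unfolding asymptotic_basis_def by blast
  have contra: False
    if sub: "B \<subseteq> lift_pair h C' G'"
      and N: "N \<ge> n\<^sub>0" "\<not> (\<exists>c'\<in>C'. \<exists>s\<in>hfold_sumset k G'. N = c' + s)" for C' G' N
  proof -
    have "h * N + k \<ge> n\<^sub>0" using N(1) h by simp
    then have "h * N + k \<in> hfold_sumset h (lift_pair h C' G')"
      using n0 hfold_sumset_mono[OF sub] by blast
    then show False using N(2) lift_pair_sumset_top[OF h] by blast
  qed
  from B obtain a where a: "a \<in> lift_pair h C G" "a \<notin> B" by blast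
  then consider c where "c \<in> C" "a = h * c" | g where "g \<in> G" "a = Suc (h * g)"
    by (auto simp: lift_pair_def)
  then show False
  proof cases
    case 1
    then have "B \<subseteq> lift_pair h (C - {c}) G" using B a(2) by (auto simp: lift_pair_def)
    then show False using contra needC[OF 1(1)] by blast
  next
    case 2
    then have "B \<subseteq> lift_pair h C (G - {g})" using B a(2) by (auto simp: lift_pair_def)
    then show False using contra needG[OF 2(1)] by blast
  qed
qed (rule basis)

section \<open>Density\<close>

text \<open>Density zero, phrased as a linear bound of arbitrarily small slope plus a constant so
  that it adds up with other counts.\<close>

definition sparse :: "nat set \<Rightarrow> bool" where
  "sparse Q \<longleftrightarrow> (\<forall>\<epsilon>>0. \<exists>K. \<forall>m. real (card (Q \<inter> {..m})) \<le> \<epsilon> * real m + K)"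

text \<open>Each block of length \<open>M\<close> contributes an initial segment whose length is a
  difference of consecutive floors. These lengths telescope, giving density
  \<open>\<delta> / M\<close> with bounded error; for \<open>1 \<le> \<delta> \<le> M\<close> every
  segment is nonempty and fits into its block.\<close>

definition block_set :: "nat \<Rightarrow> real \<Rightarrow> nat set" where
  "block_set M \<delta> = {x. int (x mod M) < \<lfloor>real (Suc (x div M)) * \<delta>\<rfloor> - \<lfloor>real (x div M) * \<delta>\<rfloor>}"

lemma floor_step:
  fixes \<delta> :: real
  assumes "1 \<le> \<delta>" and "\<delta> \<le> real M"
  shows "1 \<le> \<lfloor>real (Suc q) * \<delta>\<rfloor> - \<lfloor>real q * \<delta>\<rfloor>"
    and "\<lfloor>real (Suc q) * \<delta>\<rfloor> - \<lfloor>real q * \<delta>\<rfloor> \<le> int M"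
proof -
  have eq: "real (Suc q) * \<delta> = real q * \<delta> + \<delta>" by (simp add: algebra_simps)
  have "real q * \<delta> + 1 \<le> real (Suc q) * \<delta>" using assms eq by linarith
  from floor_mono[OF this] show "1 \<le> \<lfloor>real (Suc q) * \<delta>\<rfloor> - \<lfloor>real q * \<delta>\<rfloor>" by simp
  have "real (Suc q) * \<delta> \<le> real q * \<delta> + of_int (int M)" using assms eq by simp
  from floor_mono[OF this] show "\<lfloor>real (Suc q) * \<delta>\<rfloor> - \<lfloor>real q * \<delta>\<rfloor> \<le> int M"
    by (subst (asm) floor_add_int[symmetric]) linarith
qed

lemma mult_in_block_set:
  assumes "1 \<le> \<delta>" and "\<delta> \<le> real M" and "M dvd x"
  shows "x \<in> block_set M \<delta>"
  using floor_step(1)[OF assms(1,2), of "x div M"] assms(3) by (auto simp: block_set_def)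

lemma card_block_set:
  assumes \<delta>: "1 \<le> \<delta>" "\<delta> \<le> real M" and M: "0 < M"
  shows "int (card (block_set M \<delta> \<inter> {..<q * M})) = \<lfloor>real q * \<delta>\<rfloor>"
proof (induction q)
  case (Suc q)
  define a where "a = nat (\<lfloor>real (Suc q) * \<delta>\<rfloor> - \<lfloor>real q * \<delta>\<rfloor>)"
  have a: "int a = \<lfloor>real (Suc q) * \<delta>\<rfloor> - \<lfloor>real q * \<delta>\<rfloor>"
    using floor_step(1)[OF \<delta>, of q] by (simp add: a_def)
  have aM: "a \<le> M" using floor_step(2)[OF \<delta>, of q] a by simp
  have "block_set M \<delta> \<inter> {..<Suc q * M} = (block_set M \<delta> \<inter> {..<q * M}) \<union> {q * M..<q * M + a}"
    (is "?L = ?R")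
  proof (intro set_eqI)
    fix x
    show "x \<in> ?L \<longleftrightarrow> x \<in> ?R"
    proof (cases "q * M \<le> x \<and> x < Suc q * M")
      case True
      then have "x div M = q" by (intro div_nat_eqI) (auto simp: mult.commute)
      then have "x \<in> block_set M \<delta> \<longleftrightarrow> int (x mod M) < int a"
        unfolding block_set_def a by simp
      moreover have "x = q * M + x mod M"
        using \<open>x div M = q\<close> div_mult_mod_eq[of x M] by simp
      ultimately have "x \<in> block_set M \<delta> \<longleftrightarrow> x < q * M + a" by linarith
      then show ?thesis using True by auto
    next
      case False
      then show ?thesis using aM by auto
    qed
  qed
  moreover have "card ?R = card (block_set M \<delta> \<inter> {..<q * M}) + card {q * M..<q * M + a}"
    by (rule card_Un_disjoint) auto
  ultimately have "card ?L = card (block_set M \<delta> \<inter> {..<q * M}) + a" by simp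
  then show ?case using Suc a by simp
qed simp

text \<open>The error comes from the incomplete last block, once in the count and once in the line
  of slope at most 1, and from one rounding.\<close>

lemma block_set_count:
  assumes \<delta>: "1 \<le> \<delta>" "\<delta> \<le> real M" and M: "0 < M"
  shows "\<bar>real (card (block_set M \<delta> \<inter> {..m})) - \<delta> / real M * real m\<bar> \<le> 2 * real M + 1"
proof -
  define q where "q = m div M"
  let ?P = "block_set M \<delta>"
  have qm: "q * M \<le> m" "m < q * M + M"
    using M dividend_less_div_times[of M m] by (auto simp: q_def)
  have lower: "card (?P \<inter> {..<q * M}) \<le> card (?P \<inter> {..m})"
    by (rule card_mono) (use qm in auto)
  have "card (?P \<inter> {..m}) \<le> card ((?P \<inter> {..<q * M}) \<union> {q * M..m})"
    by (rule card_mono) auto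
  also have "\<dots> \<le> card (?P \<inter> {..<q * M}) + card {q * M..m}" by (rule card_Un_le)
  also have "\<dots> \<le> card (?P \<inter> {..<q * M}) + M" using qm by simp
  finally have upper: "card (?P \<inter> {..m}) \<le> card (?P \<inter> {..<q * M}) + M" .
  have c: "real (card (?P \<inter> {..<q * M})) = of_int \<lfloor>real q * \<delta>\<rfloor>"
    using card_block_set[OF assms, of q] by linarith
  define t where "t = \<delta> / real M * real m"
  have rM: "real M > 0" using M by simp
  have rqm: "real (q * M) \<le> real m" "real m \<le> real (q * M + M)" using qm by linarith+
  have "real q * \<delta> = \<delta> / real M * real (q * M)" using rM by simp
  also have "\<dots> \<le> t" unfolding t_def using rqm(1) \<delta> rM by (intro mult_left_mono) auto
  finally have t1: "real q * \<delta> \<le> t" .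
  have "t \<le> \<delta> / real M * real (q * M + M)" unfolding t_def using rqm(2) \<delta> rM
    by (intro mult_left_mono) auto
  also have "\<dots> = real q * \<delta> + \<delta>" using rM by (simp add: field_simps)
  finally have t2: "t \<le> real q * \<delta> + real M" using \<delta> by linarith
  have f: "of_int \<lfloor>real q * \<delta>\<rfloor> \<le> real q * \<delta>" "real q * \<delta> < of_int \<lfloor>real q * \<delta>\<rfloor> + 1"
    by linarith+
  have "real (card (?P \<inter> {..<q * M})) \<le> real (card (?P \<inter> {..m}))"
    "real (card (?P \<inter> {..m})) \<le> real (card (?P \<inter> {..<q * M})) + real M"
    using lower upper by linarith+
  then show ?thesis using c t1 t2 f unfolding t_def[symmetric] by linarith
qed

section \<open>Density of the lifted set\<close>

lemma counting_eq_card: "counting A x = card (A \<inter> {1..nat \<lfloor>x\<rfloor>})"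
proof -
  have "1 \<le> real a \<and> real a \<le> x \<longleftrightarrow> a \<in> {1..nat \<lfloor>x\<rfloor>}" for a
  proof (cases "1 \<le> a")
    case True
    then have "a \<le> nat \<lfloor>x\<rfloor> \<longleftrightarrow> int a \<le> \<lfloor>x\<rfloor>" by linarith
    then show ?thesis using True by (simp add: le_floor_iff)
  qed simp
  then have "{a \<in> A. 1 \<le> real a \<and> real a \<le> x} = A \<inter> {1..nat \<lfloor>x\<rfloor>}" by blast
  then show ?thesis by (simp add: counting_def)
qed

lemma counting_lift_pair:
  assumes "0 < h"
  shows "card (C \<inter> {1..nat \<lfloor>x\<rfloor> div h}) \<le> counting (lift_pair h C G) x"
    and "counting (lift_pair h C G) x
      \<le> card (C \<inter> {..nat \<lfloor>x\<rfloor> div h}) + card (G \<inter> {..nat \<lfloor>x\<rfloor> div h})"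
proof -
  let ?n = "nat \<lfloor>x\<rfloor>"
  have le: "h * c \<le> ?n \<longleftrightarrow> c \<le> ?n div h" for c
    using assms by (simp add: less_eq_div_iff_mult_less_eq mult.commute)
  have "card (C \<inter> {1..?n div h}) = card ((\<lambda>c. h * c) ` (C \<inter> {1..?n div h}))"
    using assms by (intro card_image[symmetric]) (auto simp: inj_on_def)
  also have "\<dots> \<le> card (lift_pair h C G \<inter> {1..?n})"
    using le assms by (intro card_mono) (auto simp: lift_pair_def)
  finally show "card (C \<inter> {1..?n div h}) \<le> counting (lift_pair h C G) x"
    by (simp add: counting_eq_card)
  have "card (lift_pair h C G \<inter> {1..?n})
      \<le> card ((\<lambda>c. h * c) ` (C \<inter> {..?n div h}) \<union> (\<lambda>g. Suc (h * g)) ` (G \<inter> {..?n div h}))"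
    using le Suc_leD[THEN le[THEN iffD1]] by (intro card_mono) (auto simp: lift_pair_def)
  also have "\<dots> \<le> card ((\<lambda>c. h * c) ` (C \<inter> {..?n div h})) + card ((\<lambda>g. Suc (h * g)) ` (G \<inter> {..?n div h}))"
    by (rule card_Un_le)
  also have "\<dots> \<le> card (C \<inter> {..?n div h}) + card (G \<inter> {..?n div h})"
    by (intro add_mono card_image_le) auto
  finally show "counting (lift_pair h C G) x
      \<le> card (C \<inter> {..?n div h}) + card (G \<inter> {..?n div h})"
    by (simp add: counting_eq_card)
qed

lemma lift_pair_density:
  assumes h: "0 < h" and Q: "sparse Q" and G: "G \<subseteq> Q"
    and C: "C \<subseteq> P \<union> Q" "P \<subseteq> C \<union> Q"
    and P: "\<And>m. \<bar>real (card (P \<inter> {..m})) - \<gamma> * real m\<bar> \<le> K"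
    and \<gamma>: "0 \<le> \<gamma>"
  shows "has_asymptotic_density (lift_pair h C G) (\<gamma> / real h)"
  unfolding has_asymptotic_density_def
proof (rule tendstoI)
  fix e :: real assume e: "e > 0"
  define A where "A = lift_pair h C G"
  \<comment> \<open>\<open>Q\<close> enters the estimate twice, so slope \<open>e / 4\<close> costs
    \<open>e / 2\<close>; the other half absorbs the constant \<open>T\<close> once \<open>x\<close>
    exceeds \<open>2 * T / e\<close>.\<close>
  from Q e obtain L where L: "\<And>m. real (card (Q \<inter> {..m})) \<le> e / 4 * real m + L"
    unfolding sparse_def by (meson divide_pos_pos zero_less_numeral)
  define T where "T = 2 * L + K + 1 + 2 * \<gamma>"
  have bound: "\<bar>real (counting A x) - \<gamma> / real h * x\<bar> \<le> e / 2 * x + T" if x: "x \<ge> 0" for x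
  proof -
    define m where "m = nat \<lfloor>x\<rfloor> div h"
    have "card (C \<inter> {..m}) \<le> card ((P \<inter> {..m}) \<union> (Q \<inter> {..m}))"
      using C by (intro card_mono) auto
    also have "\<dots> \<le> card (P \<inter> {..m}) + card (Q \<inter> {..m})" by (rule card_Un_le)
    finally have 1: "card (C \<inter> {..m}) \<le> card (P \<inter> {..m}) + card (Q \<inter> {..m})" .
    have 2: "card (G \<inter> {..m}) \<le> card (Q \<inter> {..m})"
      using G by (intro card_mono) auto
    \<comment> \<open>The counting function starts at 1, so 0 is set aside at a cost of one.\<close>
    have "card (P \<inter> {..m}) \<le> card ((C \<inter> {1..m}) \<union> (Q \<inter> {..m}) \<union> {0})"
      using C by (intro card_mono) auto
    also have "\<dots> \<le> card ((C \<inter> {1..m}) \<union> (Q \<inter> {..m})) + card {0::nat}" by (rule card_Un_le)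
    also have "\<dots> \<le> card (C \<inter> {1..m}) + card (Q \<inter> {..m}) + 1"
      using card_Un_le[of "C \<inter> {1..m}" "Q \<inter> {..m}"] by simp
    finally have 3: "card (P \<inter> {..m}) \<le> card (C \<inter> {1..m}) + card (Q \<inter> {..m}) + 1" .
    note cnt = counting_lift_pair[OF h, where C = C and G = G and x = x, folded A_def m_def]
    have 4: "\<bar>real (counting A x) - real (card (P \<inter> {..m}))\<bar> \<le> 2 * real (card (Q \<inter> {..m})) + 1"
      using cnt 1 2 3 by linarith
    have rh: "real h \<ge> 1" using h by simp
    have "m * h \<le> nat \<lfloor>x\<rfloor>" "nat \<lfloor>x\<rfloor> < m * h + h"
      using h dividend_less_div_times[of h "nat \<lfloor>x\<rfloor>"] by (auto simp: m_def)
    then have "real (m * h) \<le> real (nat \<lfloor>x\<rfloor>)" "real (nat \<lfloor>x\<rfloor>) + 1 \<le> real (m * h + h)"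
      by linarith+
    then have hm: "real m * real h \<le> x" "x \<le> real m * real h + real h"
      using x by (simp_all, linarith+)
    then have m1: "real m \<le> x / real h" "x / real h \<le> real m + 1"
      using rh by (simp_all add: field_simps)
    have "x / real h \<le> x / 1" using x rh by (intro divide_left_mono) auto
    then have mx: "real m \<le> x" using m1 by simp
    have "\<gamma> * real m \<le> \<gamma> * (x / real h)" "\<gamma> * (x / real h) \<le> \<gamma> * (real m + 1)"
      using m1[THEN mult_left_mono, OF \<gamma>] by blast+
    then have 5: "\<bar>\<gamma> * real m - \<gamma> / real h * x\<bar> \<le> \<gamma>" by (simp add: algebra_simps)
    have "e / 4 * real m \<le> e / 4 * x" using mx e by (intro mult_left_mono) auto
    then have 6: "2 * real (card (Q \<inter> {..m})) \<le> e / 2 * x + 2 * L" using L[of m] by linarith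
    show ?thesis using 4 5 6 P[of m] \<gamma> unfolding T_def by linarith
  qed
  show "\<forall>\<^sub>F x in at_top. dist (real (counting (lift_pair h C G) x) / x) (\<gamma> / real h) < e"
    using eventually_gt_at_top[of "max 0 (2 * T / e)"]
  proof eventually_elim
    case (elim x)
    then have x: "x > 0" "2 * T / e < x" by auto
    then have T: "T < e / 2 * x" using e by (simp add: field_simps)
    have "\<bar>real (counting A x) - \<gamma> / real h * x\<bar> < e * x"
      using bound[of x] x T by simp
    then have "\<bar>real (counting A x) - \<gamma> / real h * x\<bar> / x < e"
      using x by (simp add: divide_less_eq)
    moreover have "real (counting A x) / x - \<gamma> / real h = (real (counting A x) - \<gamma> / real h * x) / x"
      using x by (simp add: field_simps)
    ultimately show ?case using x by (simp add: dist_real_def A_def)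
  qed
qed

section \<open>The construction\<close>

locale construction =
  fixes k M :: nat and P :: "nat set"
  assumes k: "1 \<le> k" and M: "odd M" and P: "\<And>x. M dvd x \<Longrightarrow> x \<in> P"
begin

section \<open>The sequence \<open>g\<close> and its k-fold sums\<close>

text \<open>The factor \<open>2 * M\<close> fixes the parity and the residue modulo
  \<open>M\<close>, \<open>8 * k\<close> separates the scales beyond the reach of k-fold sums, and
  \<open>Suc n\<close> makes the ratio of consecutive terms unbounded, as sparsity of the windows
  requires.\<close>

primrec g :: "nat \<Rightarrow> nat" where
  "g 0 = 0"
| "g (Suc n) = 2 * Suc n + 2 * M * (8 * k * (Suc n * (g n + 1)))"

declare g.simps(2) [simp del]

definition G :: "nat set" where "G = range g"

lemma M_pos: "1 \<le> M"
  using M by (cases M) auto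

lemma g_step: "16 * (k * (Suc n * (g n + 1))) \<le> g (Suc n)"
proof -
  have "1 * (16 * (k * (Suc n * (g n + 1)))) \<le> M * (16 * (k * (Suc n * (g n + 1))))"
    using M_pos by (intro mult_le_mono1) simp
  then show ?thesis unfolding g.simps(2) by (simp only: mult_ac)
qed

lemma g_growth: "16 * (k * g n) + 16 * k \<le> g (Suc n)"
proof -
  have "16 * (k * (1 * (g n + 1))) \<le> 16 * (k * (Suc n * (g n + 1)))"
    by (intro mult_le_mono order_refl) simp
  then show ?thesis using g_step[of n] by (simp add: algebra_simps)
qed

lemma le_k_mult: "n \<le> k * n"
  using k by (cases k) auto

lemma g_strict_mono: "strict_mono g"
  unfolding strict_mono_Suc_iff
proof
  fix n show "g n < g (Suc n)" using g_growth[of n] le_k_mult[of "g n"] k by linarith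
qed

lemma g_mono: "m \<le> n \<Longrightarrow> g m \<le> g n"
  using g_strict_mono by (simp add: strict_mono_less_eq)

lemma le_g: "n \<le> g n"
  using g_strict_mono by (rule strict_mono_imp_increasing)

lemma even_g: "even (g n)"
  by (cases n) (auto simp: g.simps(2))

lemma even_sumset_G: "s \<in> hfold_sumset n G \<Longrightarrow> even s"
  using even_hfold_sumset[of G] even_g by (auto simp: G_def)

lemma zero_in_G: "0 \<in> G"
  by (metis G_def g.simps(1) rangeI)

lemma g_in_G: "g n \<in> G"
  by (simp add: G_def)

lemma g_mod: "g n mod M = 2 * n mod M"
proof (cases n)
  case (Suc p)
  have "g n = 2 * n + M * (2 * (8 * k * (Suc p * (g p + 1))))"
    by (simp only: Suc g.simps(2) mult_ac)
  then show ?thesis by (simp only: mod_mult_self2)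
qed simp

text \<open>Since \<open>M\<close> is odd, the numbers \<open>2 * j\<close> with
  \<open>j < M\<close> cover all residues modulo \<open>M\<close>.\<close>

lemma exists_g_congruent:
  assumes "g M \<le> y"
  shows "\<exists>j<M. g j \<le> y \<and> M dvd y - g j"
proof -
  define r where "r = y mod M"
  have r: "r < M" using M_pos by (simp add: r_def)
  obtain j where j: "j < M" "2 * j mod M = r"
  proof (cases "even r")
    case True
    then obtain j where "r = 2 * j" by blast
    then show ?thesis using that[of j] r by simp
  next
    case False
    then have "even (r + M)" using M by simp
    then obtain j where j: "r + M = 2 * j" by blast
    then have "2 * j mod M = r" using r by (metis mod_add_self2 mod_less)
    moreover have "j < M" using r j by linarith
    ultimately show ?thesis using that by blast
  qed
  have le: "g j \<le> y" using g_mono[of j M] j(1) assms by simp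
  have "y mod M = g j mod M" using j(2) by (simp add: g_mod r_def)
  then have "M dvd y - g j" using le mod_eq_dvd_iff_nat by blast
  then show ?thesis using j(1) le by blast
qed

text \<open>Terms beyond \<open>g (Suc n)\<close> are too large to occur; \<open>j\<close> counts
  the terms equal to \<open>g (Suc n)\<close>, and the remaining ones are at most
  \<open>g n\<close>. By the growth of \<open>g\<close>, \<open>j\<close> behaves like a leading
  digit.\<close>

lemma sumset_G_decompose:
  "s \<in> hfold_sumset m G \<Longrightarrow> s < g (Suc (Suc n)) \<Longrightarrow>
    \<exists>j r. j \<le> m \<and> r \<le> (m - j) * g n \<and> s = j * g (Suc n) + r"
proof (induction m arbitrary: s)
  case 0
  then show ?case by (simp add: hfold_sumset_0)
next
  case (Suc m)
  then obtain t a where t: "s = t + g a" "t \<in> hfold_sumset m G"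
    by (auto simp: hfold_sumset_Suc G_def)
  then have "t < g (Suc (Suc n))" "g a < g (Suc (Suc n))" using Suc.prems by auto
  then obtain j r where jr: "j \<le> m" "r \<le> (m - j) * g n" "t = j * g (Suc n) + r"
    using Suc.IH[OF t(2)] by blast
  have "a \<le> Suc n" using \<open>g a < _\<close> g_strict_mono by (simp add: strict_mono_less)
  then consider "a = Suc n" | "a \<le> n" by linarith
  then show ?case
  proof cases
    case 1
    then have "s = Suc j * g (Suc n) + r" using t jr by simp
    moreover have "r \<le> (Suc m - Suc j) * g n" using jr by simp
    moreover have "Suc j \<le> Suc m" using jr(1) by simp
    ultimately show ?thesis by (intro exI[of _ "Suc j"] exI[of _ r] conjI)
  next
    case 2
    then have "g a \<le> g n" by (rule g_mono)
    then have "r + g a \<le> (Suc m - j) * g n" using jr by (simp add: Suc_diff_le)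
    moreover have "s = j * g (Suc n) + (r + g a)" using t jr by simp
    moreover have "j \<le> Suc m" using jr(1) by simp
    ultimately show ?thesis by (intro exI[of _ j] exI[of _ "r + g a"] conjI)
  qed
qed

text \<open>Adding \<open>k * g n\<close> causes no carry, so both sums have the same leading digit
  \<open>j\<close>. Then \<open>r + k * g n\<close> must still fit into
  \<open>(k - j) * g n\<close>, which forces \<open>j\<close> and \<open>r\<close> to
  vanish.\<close>

lemma sumset_G_shift:
  assumes s: "s \<in> hfold_sumset k G" and s': "s + k * g n \<in> hfold_sumset k G"
    and less: "s + k * g n < g (Suc (Suc n))" and n: "0 < n"
  shows "s = 0"
proof -
  have "s < g (Suc (Suc n))" using less by simp
  from sumset_G_decompose[OF s this]
  obtain j r where jr: "j \<le> k" "r \<le> (k - j) * g n" "s = j * g (Suc n) + r" by (elim exE conjE)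
  from sumset_G_decompose[OF s' less]
  obtain j' r' where jr': "j' \<le> k" "r' \<le> (k - j') * g n" "s + k * g n = j' * g (Suc n) + r'"
    by (elim exE conjE)
  have "(k - j) * g n \<le> k * g n" "(k - j') * g n \<le> k * g n" by (intro mult_le_mono1; simp)+
  then have small: "r + k * g n < g (Suc n)" "r' < g (Suc n)"
    using g_growth[of n] jr jr' k by linarith+
  have eq: "j * g (Suc n) + (r + k * g n) = j' * g (Suc n) + r'" using jr jr' by simp
  have "j = (j * g (Suc n) + (r + k * g n)) div g (Suc n)"
    using small(1) by simp
  also have "\<dots> = j'" unfolding eq using small(2) by simp
  finally have j: "j = j'" .
  then have "r + k * g n \<le> (k - j) * g n" using eq jr' by simp
  moreover have "(k - j) * g n + j * g n = k * g n" using jr(1) by (simp flip: add_mult_distrib)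
  ultimately have "r + j * g n \<le> 0" by linarith
  moreover have "g n > 0" using le_g[of n] n by simp
  ultimately show ?thesis using jr by simp
qed

text \<open>Without \<open>g d\<close>, the usable terms are at most its predecessor, and
  \<open>k\<close> of those fall short of \<open>g d\<close>; for \<open>d = 0\<close> the terms
  left are all positive.\<close>

lemma g_not_in_sumset_without: "g d \<notin> hfold_sumset k (G - {g d})"
proof
  assume s: "g d \<in> hfold_sumset k (G - {g d})"
  show False
  proof (cases d)
    case 0
    obtain m where m: "k = Suc m" using k by (cases k) auto
    have "g d \<in> hfold_sumset (Suc m) (G - {g d})" using s by (simp only: m[symmetric])
    then show False using 0 unfolding hfold_sumset_Suc by auto
  next
    case (Suc p)
    have "a \<le> g p" if "a \<in> G - {g d}" "a \<le> g d" for a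
    proof -
      obtain n where n: "a = g n" using \<open>a \<in> G - _\<close> by (auto simp: G_def)
      then have "n \<le> d" "n \<noteq> d" using that g_strict_mono by (auto simp: strict_mono_less_eq)
      then show ?thesis using n Suc g_mono by simp
    qed
    then have "g d \<le> k * g p" using in_hfold_sumset_le[OF s] by blast
    then show False using g_growth[of p] k Suc by simp
  qed
qed

section \<open>Windows around the first multiples of each \<open>g (Suc n)\<close>\<close>

text \<open>The radius is \<open>3 * (k * g n)\<close>: deleted points stay within
  \<open>k * g n\<close> of a multiple, and the search for representations moves at most twice as
  far from them. Adding on both sides avoids truncated subtraction.\<close>

definition window :: "nat \<Rightarrow> nat set" where
  "window n = {x. \<exists>l\<in>{1..Suc k}. l * g (Suc n) \<le> x + 3 * (k * g n) \<and> x \<le> l * g (Suc n) + 3 * (k * g n)}"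

lemma window_lower:
  assumes "x \<in> window n"
  shows "g (Suc n) \<le> 2 * x"
proof -
  obtain l where l: "1 \<le> l" "l * g (Suc n) \<le> x + 3 * (k * g n)"
    using assms by (auto simp: window_def)
  have "1 * g (Suc n) \<le> l * g (Suc n)" using l(1) by (rule mult_le_mono1)
  then show ?thesis using l g_growth[of n] by linarith
qed

lemma window_upper:
  assumes "x \<in> window n"
  shows "x \<le> (k + 2) * g (Suc n)"
proof -
  obtain l where l: "l \<le> Suc k" "x \<le> l * g (Suc n) + 3 * (k * g n)"
    using assms by (auto simp: window_def)
  have "l * g (Suc n) \<le> Suc k * g (Suc n)" using l(1) by (rule mult_le_mono1)
  moreover have "(k + 2) * g (Suc n) = Suc k * g (Suc n) + g (Suc n)" by simp
  ultimately show ?thesis using l g_growth[of n] by linarith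
qed

lemma g_gap: "2 * ((k + 2) * g n) < g (Suc n)"
proof -
  have "2 * ((k + 2) * g n) = 2 * (k * g n) + 4 * g n" by (simp add: algebra_simps)
  then show ?thesis using g_growth[of n] le_k_mult[of "g n"] k by linarith
qed

lemma window_less: "x \<in> window n \<Longrightarrow> 2 * x < g (Suc (Suc n))"
  using window_upper[of x n] g_gap[of "Suc n"] by linarith

text \<open>For \<open>x\<close> in \<open>window n\<close>, \<open>2 * x\<close> lies between
  \<open>g (Suc n)\<close> and \<open>g (Suc (Suc n))\<close>, the latter excluded, and this
  determines \<open>n\<close>.\<close>

lemma window_unique:
  assumes "x \<in> window m" and "x \<in> window n"
  shows "m = n"
proof -
  have "\<not> a < b" if "x \<in> window a" "x \<in> window b" for a b
    using window_less[OF that(1)] window_lower[OF that(2)] g_mono[of "Suc (Suc a)" "Suc b"] by linarith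
  then show ?thesis using assms by (meson linorder_neqE_nat)
qed

text \<open>Stage \<open>i\<close> works with \<open>g (Suc (i + M))\<close>. Its task \<open>2 * c\<close> is to make \<open>c\<close> indispensable in \<open>C\<close>,
  and its task \<open>2 * d + 1\<close> to make \<open>g d\<close> indispensable in \<open>G\<close>; the pairing function repeats
  every task infinitely often.\<close>

definition task :: "nat \<Rightarrow> nat" where "task i = fst (prod_decode i)"

definition mark :: "nat \<Rightarrow> nat" where
  "mark i = (if even (task i) then task i div 2 else g (task i div 2))"

text \<open>The shift by \<open>M\<close> puts every stage above the numbers up to \<open>M\<close>
  and above the shifts \<open>g j\<close> with \<open>j < M\<close>.\<close>

definition target :: "nat \<Rightarrow> nat" where
  "target i = (if even (task i) then k else Suc k) * g (Suc (i + M)) + mark i"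

definition unwanted_sums :: "nat \<Rightarrow> nat set" where
  "unwanted_sums i = (if even (task i) then hfold_sumset k G - {k * g (Suc (i + M))}
     else hfold_sumset k (G - {mark i}))"

definition deleted :: "nat \<Rightarrow> nat set" where
  "deleted i = {target i - s | s. s \<in> unwanted_sums i \<and> s \<le> target i}"

section \<open>Location and parity of the deleted points\<close>

lemma task_le: "task i \<le> i"
  using le_prod_encode_1[of "fst (prod_decode i)" "snd (prod_decode i)"]
  by (simp add: task_def)

lemma mark_le: "mark i \<le> g (i + M)"
proof -
  have "task i div 2 \<le> i + M" using task_le[of i] by linarith
  then show ?thesis using le_g[of "i + M"] g_mono by (auto simp: mark_def)
qed

lemma target_less: "target i < g (Suc (Suc (i + M)))"
proof -
  have "target i \<le> Suc k * g (Suc (i + M)) + g (Suc (i + M))"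
    unfolding target_def using mark_le[of i] g_mono[of "i + M" "Suc (i + M)"]
    by (intro add_mono mult_le_mono1) auto
  also have "\<dots> = (k + 2) * g (Suc (i + M))" by simp
  also have "\<dots> < g (Suc (Suc (i + M)))" using g_gap[of "Suc (i + M)"] by linarith
  finally show ?thesis .
qed

lemma unwanted_sums_subset: "unwanted_sums i \<subseteq> hfold_sumset k G"
  using hfold_sumset_mono[of "G - {mark i}" G k] by (auto simp: unwanted_sums_def)

lemma deleted_near_multiple:
  assumes "e \<in> deleted i"
  shows "\<exists>l\<in>{1..Suc k}. l * g (Suc (i + M)) \<le> e + k * g (i + M) \<and>
    e \<le> l * g (Suc (i + M)) + k * g (i + M)"
proof -
  let ?b = "g (Suc (i + M))" and ?p = "g (i + M)"
  define u where "u = (if even (task i) then k else Suc k)"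
  obtain s where s: "s \<in> unwanted_sums i" "s \<le> target i" "e + s = target i"
    using assms by (auto simp: deleted_def)
  then have "s < g (Suc (Suc (i + M)))" using target_less[of i] by linarith
  moreover have "s \<in> hfold_sumset k G" using unwanted_sums_subset s(1) by blast
  ultimately obtain j r where jr: "j \<le> k" "r \<le> (k - j) * ?p" "s = j * ?b + r"
    by (meson sumset_G_decompose)
  \<comment> \<open>For an even task, \<open>j = k\<close> leaves remainder 0, so \<open>s\<close>
    would be the one sum excluded from \<open>unwanted_sums\<close>. Hence a positive multiple of
    \<open>?b\<close> remains, and nothing is deleted near 0.\<close>
  have "j < u"
  proof (cases "even (task i)")
    case True
    then have "s \<noteq> k * ?b" using s(1) by (simp add: unwanted_sums_def)
    then have "j \<noteq> k" using jr by auto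
    then show ?thesis using jr(1) True by (simp add: u_def)
  qed (use jr in \<open>simp add: u_def\<close>)
  then have l: "u - j \<in> {1..Suc k}" by (auto simp: u_def)
  have "(u - j) * ?b + j * ?b = u * ?b" using \<open>j < u\<close> by (simp flip: add_mult_distrib)
  then have "e + r = (u - j) * ?b + mark i"
    using s(3) jr(3) unfolding target_def u_def[symmetric] by linarith
  moreover have "(k - j) * ?p \<le> k * ?p" by (rule mult_le_mono1) simp
  ultimately have "(u - j) * ?b \<le> e + k * ?p \<and> e \<le> (u - j) * ?b + k * ?p"
    using jr(2) mark_le[of i] le_k_mult[of ?p] by linarith
  then show ?thesis using l by blast
qed

lemma near_deleted_in_window:
  assumes "e \<in> deleted i" and "x \<le> e + 2 * (k * g (i + M))" and "e \<le> x + 2 * (k * g (i + M))"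
  shows "x \<in> window (i + M)"
proof -
  obtain l where "l \<in> {1..Suc k}" "l * g (Suc (i + M)) \<le> e + k * g (i + M)"
    "e \<le> l * g (Suc (i + M)) + k * g (i + M)"
    using deleted_near_multiple[OF assms(1)] by blast
  moreover from this have "l * g (Suc (i + M)) \<le> x + 3 * (k * g (i + M))"
    "x \<le> l * g (Suc (i + M)) + 3 * (k * g (i + M))"
    using assms(2,3) by linarith+
  ultimately show ?thesis unfolding window_def by blast
qed

lemma deleted_subset_window: "deleted i \<subseteq> window (i + M)"
  using near_deleted_in_window by auto

lemma deleted_parity: "e \<in> deleted i \<Longrightarrow> even e \<longleftrightarrow> even (target i)"
  using unwanted_sums_subset even_sumset_G by (fastforce simp: deleted_def)

section \<open>The surviving set \<open>C\<close>\<close>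

definition base :: "nat set" where "base = P \<union> {..M} \<union> (\<Union>n. window n)"

text \<open>A stage that is meant to make \<open>c\<close> indispensable is carried out only if \<open>c\<close> has survived
  the earlier stages; later stages delete only numbers larger than \<open>c\<close>.\<close>

primrec removed :: "nat \<Rightarrow> nat set" where
  "removed 0 = {}"
| "removed (Suc i) = removed i \<union>
     (if odd (task i) \<or> mark i \<in> base - removed i then deleted i else {})"

definition active :: "nat \<Rightarrow> bool" where
  "active i \<longleftrightarrow> odd (task i) \<or> mark i \<in> base - removed i"

definition C :: "nat set" where "C = base - (\<Union>i. removed i)"

lemma in_removed_iff: "x \<in> removed i \<longleftrightarrow> (\<exists>j<i. active j \<and> x \<in> deleted j)"
  by (induction i) (auto simp: active_def less_Suc_eq)

lemma in_C_iff: "x \<in> C \<longleftrightarrow> x \<in> base \<and> (\<forall>j. active j \<longrightarrow> x \<notin> deleted j)"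
  by (auto simp: C_def in_removed_iff)

text \<open>Activity looks only at earlier removals, but stages from \<open>i\<close> on delete only
  in windows far above \<open>mark i\<close>, so surviving up to stage \<open>i\<close> means
  surviving forever.\<close>

lemma active_even_iff:
  assumes "even (task i)"
  shows "active i \<longleftrightarrow> mark i \<in> C"
proof
  assume "active i"
  then have base: "mark i \<in> base" and rem: "mark i \<notin> removed i"
    using assms by (auto simp: active_def)
  have "mark i \<notin> deleted j" if "active j" for j
  proof (cases "j < i")
    case True
    then show ?thesis using rem that in_removed_iff by blast
  next
    case False
    then have "g (i + M) \<le> g (j + M)" by (intro g_mono) simp
    then have "2 * mark i < g (Suc (j + M))"
      using mark_le[of i] g_growth[of "j + M"] le_k_mult[of "g (j + M)"] k by linarith
    then show ?thesis using deleted_subset_window window_lower not_le by blast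
  qed
  then show "mark i \<in> C" using base in_C_iff by blast
next
  assume "mark i \<in> C"
  then show "active i" by (auto simp: active_def C_def)
qed

text \<open>Distinct windows are disjoint, so stage \<open>i\<close> is the only one that can delete
  from this window.\<close>

lemma window_diff_deleted_in_C:
  assumes "x \<in> window (i + M)" and "x \<notin> deleted i"
  shows "x \<in> C"
proof -
  have "x \<notin> deleted j" for j
    using assms deleted_subset_window[of j] window_unique[of x "i + M" "j + M"] by auto
  then show ?thesis using assms(1) by (auto simp: in_C_iff base_def)
qed

text \<open>These numbers lie below every deleted point; they supply the remainders for
  \<open>C + C\<close> and the element 0.\<close>

lemma le_M_in_C:
  assumes "x \<le> M"
  shows "x \<in> C"
proof -
  have "x \<notin> deleted j" for j
  proof
    assume "x \<in> deleted j"
    then have "g (Suc (j + M)) \<le> 2 * x" using deleted_subset_window window_lower by blast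
    moreover have "M \<le> g (j + M)" using le_g[of "j + M"] by simp
    ultimately show False
      using assms g_growth[of "j + M"] le_k_mult[of "g (j + M)"] k by linarith
  qed
  then show ?thesis using assms by (auto simp: in_C_iff base_def)
qed

section \<open>Every large integer is represented\<close>

lemma multiple_of_M_cases:
  assumes "M dvd x"
  obtains "x \<in> C" | i where "active i" and "x \<in> deleted i"
  using P[OF assms] by (auto simp: in_C_iff base_def)

text \<open>If the multiple of \<open>M\<close> just below \<open>y\<close> was deleted, one unit is
  moved to the remainder: the predecessor has the wrong parity to be deleted, and the new remainder
  is still at most \<open>M\<close>.\<close>

lemma C_plus_C:
  obtains c d where "c \<in> C" and "d \<in> C" and "y = c + d"
proof -
  let ?e = "y - y mod M"
  have y: "y = ?e + y mod M" by simp
  have r: "y mod M < M" using M_pos by simp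
  have "M dvd ?e" by (rule dvd_minus_mod)
  then show thesis
  proof (cases rule: multiple_of_M_cases)
    case 1
    then show thesis using that[OF _ _ y] le_M_in_C r by simp
  next
    case (2 i)
    have "1 \<le> g (Suc (i + M))" using le_g[of "Suc (i + M)"] by simp
    then have e: "1 \<le> ?e" using 2 deleted_subset_window window_lower[of ?e "i + M"] by fastforce
    have "1 \<le> g (i + M)" using le_g[of "i + M"] M_pos by simp
    then have "?e - 1 \<in> window (i + M)"
      using le_k_mult[of "g (i + M)"] by (intro near_deleted_in_window[OF 2(2)]) linarith+
    moreover have "?e - 1 \<notin> deleted i"
      using deleted_parity[OF 2(2)] deleted_parity[of "?e - 1" i] e by auto
    ultimately have "?e - 1 \<in> C" by (rule window_diff_deleted_in_C)
    moreover have "y mod M + 1 \<in> C" using r by (intro le_M_in_C) simp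
    moreover have "y = (?e - 1) + (y mod M + 1)" using e y by linarith
    ultimately show thesis using that by blast
  qed
qed

text \<open>If the candidate \<open>y - g j\<close> was deleted at stage \<open>i\<close>, then
  \<open>y\<close> is close to it, and \<open>y\<close> and \<open>y - k * g (i + M)\<close> serve
  as further candidates. Both can fail only for the target of the stage, which is treated
  directly.\<close>

lemma C_plus_sumset_G:
  assumes "g M \<le> y"
  shows "\<exists>c\<in>C. \<exists>s\<in>hfold_sumset k G. y = c + s"
proof -
  obtain j where j: "j < M" "g j \<le> y" "M dvd y - g j" using exists_g_congruent[OF assms] by blast
  have elem: "g n \<in> hfold_sumset k G" for n
    using elem_in_hfold_sumset g_in_G zero_in_G k by blast
  from j(3) show ?thesis
  proof (cases rule: multiple_of_M_cases)
    case 1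
    then show ?thesis using elem[of j] j(2) by force
  next
    case (2 i)
    let ?b = "g (Suc (i + M))" and ?p = "g (i + M)"
    have jp: "g j \<le> ?p" using j(1) by (intro g_mono) simp
    show ?thesis
    proof (cases "y = target i")
      case True
      show ?thesis
      proof (cases "even (task i)")
        case even: True
        then have "mark i \<in> C" using 2 active_even_iff by blast
        moreover have "k * ?b \<in> hfold_sumset k G" using mult_in_hfold_sumset g_in_G by blast
        moreover have "y = mark i + k * ?b" using True even by (simp add: target_def)
        ultimately show ?thesis by blast
      next
        case odd: False
        then obtain d where d: "mark i = g d" by (auto simp: mark_def)
        have y: "y = Suc k * ?b + mark i" using True odd by (simp add: target_def)
        have "Suc k * ?b \<in> window (i + M)"
          unfolding window_def by (intro CollectI bexI[of _ "Suc k"]) auto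
        \<comment> \<open>Its deletion would make \<open>g d\<close> a k-fold sum of elements of
          \<open>G\<close> other than \<open>g d\<close>.\<close>
        moreover have "Suc k * ?b \<notin> deleted i"
        proof
          assume "Suc k * ?b \<in> deleted i"
          then obtain s where "s \<in> unwanted_sums i" "s \<le> target i" "Suc k * ?b = target i - s"
            by (auto simp: deleted_def)
          then have "mark i \<in> unwanted_sums i" using y True by (metis add_diff_cancel_left' diff_diff_cancel)
          then show False using g_not_in_sumset_without[of d] odd d by (simp add: unwanted_sums_def)
        qed
        ultimately have "Suc k * ?b \<in> C" by (rule window_diff_deleted_in_C)
        then show ?thesis using y elem[of d] d by auto
      qed
    next
      case False
      have y: "y \<in> window (i + M)"
        using jp le_k_mult[of ?p] j(2) by (intro near_deleted_in_window[OF 2(2)]) linarith+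
      have le: "k * ?p \<le> y" using window_lower[OF y] g_growth[of "i + M"] by linarith
      have y': "y - k * ?p \<in> window (i + M)"
        using jp le_k_mult[of ?p] j(2) le by (intro near_deleted_in_window[OF 2(2)]) linarith+
      have "y \<notin> deleted i \<or> y - k * ?p \<notin> deleted i"
      proof (rule ccontr)
        assume "\<not> ?thesis"
        then obtain s s' where s: "s \<in> unwanted_sums i" "s \<le> target i" "y = target i - s"
          and s': "s' \<in> unwanted_sums i" "s' \<le> target i" "y - k * ?p = target i - s'"
          by (auto simp: deleted_def)
        then have eq: "s' = s + k * ?p" using le by linarith
        \<comment> \<open>Two k-fold sums below the next scale differ by \<open>k * ?p\<close>; this
          forces \<open>s = 0\<close>, so \<open>y\<close> would be the target.\<close>
        have "s = 0"
        proof (rule sumset_G_shift)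
          show "s \<in> hfold_sumset k G" "s + k * ?p \<in> hfold_sumset k G"
            using s s' eq unwanted_sums_subset by auto
          show "s + k * ?p < g (Suc (Suc (i + M)))" using s' eq target_less[of i] by linarith
          show "0 < i + M" using M_pos by simp
        qed
        then show False using s False by simp
      qed
      then show ?thesis
      proof
        assume "y \<notin> deleted i"
        then have "y \<in> C" using y window_diff_deleted_in_C by blast
        then show ?thesis using elem[of 0] by force
      next
        assume "y - k * ?p \<notin> deleted i"
        then have "y - k * ?p \<in> C" using y' window_diff_deleted_in_C by blast
        moreover have "k * ?p \<in> hfold_sumset k G" using mult_in_hfold_sumset g_in_G by blast
        moreover have "y = (y - k * ?p) + k * ?p" using le by simp
        ultimately show ?thesis by blast
      qed
    qed
  qed
qed

section \<open>Indispensability of every element of \<open>C\<close> and \<open>G\<close>\<close>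

lemma target_ge: "i \<le> target i"
proof -
  have "1 * g (Suc (i + M)) \<le> (if even (task i) then k else Suc k) * g (Suc (i + M))"
    using k by (intro mult_le_mono1) simp
  then show ?thesis using le_g[of "Suc (i + M)"] unfolding target_def by linarith
qed

lemma exists_stage: "\<exists>i\<ge>m. task i = t"
  using le_prod_encode_2[of m t] by (intro exI[of _ "prod_encode (t, m)"]) (simp add: task_def)

lemma C_indispensable:
  assumes "c \<in> C"
  shows "\<exists>N\<ge>m. \<not> (\<exists>c'\<in>C - {c}. \<exists>s\<in>hfold_sumset k G. N = c' + s)"
proof -
  obtain i where i: "m \<le> i" "task i = 2 * c" using exists_stage by blast
  then have mark: "mark i = c" by (simp add: mark_def)
  then have act: "active i" using assms active_even_iff i by simp
  have "target i \<noteq> c' + s" if "c' \<in> C - {c}" "s \<in> hfold_sumset k G" for c' s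
  proof
    assume eq: "target i = c' + s"
    \<comment> \<open>With equality, cancelling in the target would give
      \<open>c' = c\<close>.\<close>
    then have "s \<noteq> k * g (Suc (i + M))" using that(1) mark i by (auto simp: target_def)
    then have "s \<in> unwanted_sums i" using that(2) i by (simp add: unwanted_sums_def)
    then have "c' \<in> deleted i" using eq unfolding deleted_def by force
    then show False using that(1) act in_C_iff by blast
  qed
  then show ?thesis using i(1) target_ge[of i] order_trans by blast
qed

lemma G_indispensable:
  assumes "x \<in> G"
  shows "\<exists>N\<ge>m. \<not> (\<exists>c'\<in>C. \<exists>s\<in>hfold_sumset k (G - {x}). N = c' + s)"
proof -
  obtain d where d: "x = g d" using assms by (auto simp: G_def)
  obtain i where i: "m \<le> i" "task i = Suc (2 * d)" using exists_stage by blast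
  then have mark: "mark i = x" by (simp add: mark_def d)
  have act: "active i" using i by (simp add: active_def)
  have "target i \<noteq> c' + s" if "c' \<in> C" "s \<in> hfold_sumset k (G - {x})" for c' s
  proof
    assume eq: "target i = c' + s"
    have "s \<in> unwanted_sums i" using that(2) i mark by (simp add: unwanted_sums_def)
    then have "c' \<in> deleted i" using eq unfolding deleted_def by force
    then show False using that(1) act in_C_iff by blast
  qed
  then show ?thesis using i(1) target_ge[of i] order_trans by blast
qed

lemma lift_pair_minimal_basis: "minimal_asymptotic_basis (Suc k) (lift_pair (Suc k) C G)"
proof (rule lift_pair_minimal[OF refl k])
  have "\<exists>c\<in>C. \<exists>d\<in>C. n = c + d" for n using C_plus_C[of n] by metis
  then show "asymptotic_basis (Suc k) (lift_pair (Suc k) C G)"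
    using lift_pair_asymptotic_basis[OF refl k, of C G "g M"] le_M_in_C[of 0] zero_in_G C_plus_sumset_G
    by blast
qed (use C_indispensable G_indispensable in blast)+

section \<open>The exceptional points have density zero\<close>

text \<open>This covers every point where \<open>C\<close> and \<open>P\<close> differ, and also
  \<open>G\<close>, since each positive \<open>g n\<close> is the centre of a window.\<close>

definition exceptional :: "nat set" where "exceptional = {..M} \<union> (\<Union>n. window n)"

lemma card_window: "card (window n) \<le> Suc k * (6 * (k * g n) + 1)"
proof -
  let ?I = "\<lambda>l. {l * g (Suc n) - 3 * (k * g n)..l * g (Suc n) + 3 * (k * g n)}"
  have "window n \<subseteq> (\<Union>l\<in>{1..Suc k}. ?I l)" unfolding window_def by fastforce
  then have "card (window n) \<le> card (\<Union>l\<in>{1..Suc k}. ?I l)" by (rule card_mono[rotated]) simp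
  also have "\<dots> \<le> (\<Sum>l\<in>{1..Suc k}. card (?I l))" by (rule card_UN_le) simp
  also have "\<dots> \<le> (\<Sum>l\<in>{1..Suc k}. 6 * (k * g n) + 1)" by (rule sum_mono) simp
  finally show ?thesis by simp
qed

text \<open>Up to \<open>m\<close> only windows of index at most \<open>p\<close> matter. The
  earlier ones lie below \<open>(k + 2) * g p\<close>, and \<open>window p\<close>, though located
  at the scale of \<open>g (Suc p)\<close>, has size only of order \<open>g p\<close>.\<close>

lemma exceptional_count:
  assumes "2 * m < g (Suc (Suc p))"
  shows "card (exceptional \<inter> {..m}) \<le> Suc M + (1 + (k + 2) + Suc k * (6 * k + 1)) * (g p + 1)"
proof -
  have fin: "finite (window p)"
    by (rule finite_subset[of _ "{..(k + 2) * g (Suc p)}"]) (auto dest: window_upper)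
  have "exceptional \<inter> {..m} \<subseteq> ({..M} \<union> {..(k + 2) * g p}) \<union> window p"
  proof
    fix x assume x: "x \<in> exceptional \<inter> {..m}"
    then consider "x \<le> M" | q where "x \<in> window q" by (auto simp: exceptional_def)
    then show "x \<in> ({..M} \<union> {..(k + 2) * g p}) \<union> window p"
    proof cases
      case (2 q)
      have "g (Suc q) < g (Suc (Suc p))" using window_lower[OF 2] x assms by simp
      then have "q < Suc p" using g_strict_mono by (simp add: strict_mono_less)
      then consider "q = p" | "Suc q \<le> p" by linarith
      then show ?thesis
      proof cases
        case qp: 2
        have "(k + 2) * g (Suc q) \<le> (k + 2) * g p" using g_mono[OF qp] by (rule mult_le_mono2)
        then show ?thesis using window_upper[OF 2] by simp
      qed (use 2 in simp)
    qed simp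
  qed
  then have "card (exceptional \<inter> {..m}) \<le> card (({..M} \<union> {..(k + 2) * g p}) \<union> window p)"
    using fin by (intro card_mono) auto
  also have "\<dots> \<le> card ({..M} \<union> {..(k + 2) * g p}) + card (window p)" by (rule card_Un_le)
  also have "\<dots> \<le> (Suc M + Suc ((k + 2) * g p)) + Suc k * (6 * (k * g p) + 1)"
    using card_Un_le[of "{..M}" "{..(k + 2) * g p}"] card_window[of p] by (intro add_mono) simp_all
  also have "\<dots> \<le> Suc M + (1 + (k + 2) + Suc k * (6 * k + 1)) * (g p + 1)"
    by (simp add: algebra_simps)
  finally show ?thesis .
qed

lemma sparse_exceptional: "sparse exceptional"
  unfolding sparse_def
proof (intro allI impI)
  fix \<epsilon> :: real assume \<epsilon>: "\<epsilon> > 0"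
  define W where "W = 1 + (k + 2) + Suc k * (6 * k + 1)"
  obtain n\<^sub>0 :: nat where "real W / \<epsilon> < real n\<^sub>0" using reals_Archimedean2 by blast
  then have n0: "real W < \<epsilon> * real n\<^sub>0" using \<epsilon> by (simp add: field_simps)
  have "real (card (exceptional \<inter> {..m})) \<le> \<epsilon> * real m + real (g (Suc n\<^sub>0) + M + 1)" for m
  proof (cases "2 * m < g (Suc n\<^sub>0)")
    case True
    have "card (exceptional \<inter> {..m}) \<le> card {..m}" by (rule card_mono) auto
    then have "card (exceptional \<inter> {..m}) \<le> g (Suc n\<^sub>0) + M + 1" using True by simp
    then show ?thesis using \<epsilon> by (simp add: add_increasing)
  next
    case False
    \<comment> \<open>With \<open>n = Suc (Suc p)\<close> this locates \<open>2 * m\<close> between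
      \<open>g (Suc p)\<close> and \<open>g (Suc (Suc p))\<close>.\<close>
    define n where "n = (LEAST n. 2 * m < g n)"
    have "2 * m < g (Suc (2 * m))" using le_g[of "Suc (2 * m)"] by simp
    then have n: "2 * m < g n" "\<And>i. i < n \<Longrightarrow> g i \<le> 2 * m"
      unfolding n_def by (metis LeastI, metis not_less_Least not_less)
    have "g (Suc n\<^sub>0) < g n" using False n by linarith
    then have "Suc n\<^sub>0 < n" using g_strict_mono by (simp add: strict_mono_less)
    then obtain p where p: "n = Suc (Suc p)" "n\<^sub>0 \<le> p" by (metis Suc_less_eq2 less_imp_Suc_add less_Suc_eq_le)
    have "Suc p * (g p + 1) \<le> k * (Suc p * (g p + 1))" by (rule le_k_mult)
    then have "Suc p * (g p + 1) \<le> m" using n(2)[of "Suc p"] p g_step[of p] by linarith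
    then have m: "real (Suc p) * real (g p + 1) \<le> real m" by (metis of_nat_le_iff of_nat_mult)
    \<comment> \<open>The factor \<open>Suc p\<close> in the growth of \<open>g\<close> now
      outweighs the constant \<open>W\<close>, as \<open>p\<close> is at least
      \<open>n\<^sub>0\<close>.\<close>
    have "\<epsilon> * real n\<^sub>0 \<le> \<epsilon> * real (Suc p)" using p \<epsilon> by (intro mult_left_mono) auto
    then have "real W * real (g p + 1) \<le> (\<epsilon> * real (Suc p)) * real (g p + 1)"
      using n0 by (intro mult_right_mono) auto
    also have "\<dots> \<le> \<epsilon> * real m" using m \<epsilon> by (simp add: mult.assoc)
    finally have W: "real W * real (g p + 1) \<le> \<epsilon> * real m" .
    have "card (exceptional \<inter> {..m}) \<le> Suc M + W * (g p + 1)"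
      using exceptional_count[of m p] n(1) p unfolding W_def by simp
    then have "real (card (exceptional \<inter> {..m})) \<le> real (Suc M) + real W * real (g p + 1)"
      by (metis of_nat_add of_nat_le_iff of_nat_mult)
    then show ?thesis using W by simp
  qed
  then show "\<exists>K. \<forall>m. real (card (exceptional \<inter> {..m})) \<le> \<epsilon> * real m + K" by blast
qed

lemma G_subset_exceptional: "G \<subseteq> exceptional"
proof -
  have "g n \<in> exceptional" for n
  proof (cases n)
    case (Suc p)
    have "g (Suc p) \<in> window p"
      unfolding window_def by (intro CollectI bexI[of _ 1]) auto
    then show ?thesis using Suc by (auto simp: exceptional_def)
  qed (simp add: exceptional_def)
  then show ?thesis by (auto simp: G_def)
qed

lemma lift_pair_C_G_density:
  assumes "\<And>m. \<bar>real (card (P \<inter> {..m})) - \<gamma> * real m\<bar> \<le> K" and "0 \<le> \<gamma>"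
  shows "has_asymptotic_density (lift_pair (Suc k) C G) (\<gamma> / real (Suc k))"
proof (rule lift_pair_density[OF _ sparse_exceptional G_subset_exceptional _ _ assms])
  show "C \<subseteq> P \<union> exceptional" by (auto simp: C_def base_def exceptional_def)
  show "P \<subseteq> C \<union> exceptional"
    using deleted_subset_window by (fastforce simp: in_C_iff base_def exceptional_def)
qed simp

end

section \<open>Choice of \<open>M\<close> and \<open>P\<close> for the prescribed density\<close>

theorem theorem1:
  fixes h :: nat and \<alpha> :: real
  assumes "h \<ge> 3" and "0 < \<alpha>" and "\<alpha> < 1 / real h"
  shows "\<exists>A'. minimal_asymptotic_basis h A' \<and> has_asymptotic_density A' \<alpha>"
proof -
  define k where "k = h - 1"
  have h: "h = Suc k" "1 \<le> k" using assms(1) by (simp_all add: k_def)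
  \<comment> \<open>Lifting divides the density of \<open>C\<close> by \<open>h\<close>, so
    \<open>C\<close> must have density \<open>h * \<alpha>\<close>, which is below 1.\<close>
  define \<gamma> where "\<gamma> = real h * \<alpha>"
  have "real h > 0" using assms(1) by simp
  then have \<gamma>: "0 < \<gamma>" "\<gamma> < 1" and \<alpha>: "\<gamma> / real (Suc k) = \<alpha>"
    using assms(2,3) by (simp_all add: \<gamma>_def field_simps flip: h(1))
  \<comment> \<open>Taking \<open>m\<close> above \<open>1 / \<gamma>\<close> gives
    \<open>\<gamma> * M \<ge> 1\<close> for the odd number \<open>M = 2 * m + 1\<close>, so every
    block of \<open>P\<close> contains its multiple of \<open>M\<close>.\<close>
  obtain m :: nat where m: "1 / \<gamma> < real m" using reals_Archimedean2 by blast
  define M where "M = Suc (2 * m)"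
  have odd_M: "odd M" and M_gt_0: "0 < M" by (simp_all add: M_def)
  have "1 < \<gamma> * real m" using m \<gamma> by (simp add: field_simps)
  also have "\<dots> \<le> \<gamma> * real M" using \<gamma> by (simp add: M_def)
  finally have \<delta>: "1 \<le> \<gamma> * real M" "\<gamma> * real M \<le> real M"
    using \<gamma> by (simp_all add: mult_left_le_one_le)
  define P where "P = block_set M (\<gamma> * real M)"
  interpret construction k M P
    by unfold_locales (use h odd_M \<delta> mult_in_block_set in \<open>auto simp: P_def\<close>)
  have "\<bar>real (card (P \<inter> {..n})) - \<gamma> * real n\<bar> \<le> 2 * real M + 1" for n
    using block_set_count[OF \<delta> M_gt_0, of n] M_gt_0 by (simp add: P_def)
  then have "has_asymptotic_density (lift_pair h C G) \<alpha>"
    using lift_pair_C_G_density[of \<gamma> "2 * real M + 1"] \<gamma> \<alpha> h by simp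
  moreover have "minimal_asymptotic_basis h (lift_pair h C G)"
    using lift_pair_minimal_basis h by simp
  ultimately show ?thesis by blast
qed

end
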